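(* Let $\Delta$ be a finite simplicial complex and let $r \ge k > p > 0$ be integers. If $f_{k-1}(\Delta) \le \binom{r}{k} + \binom{r-1}{k-1}$, then $$f_{p-1}(\Delta) \ge \binom{r}{p}\binom{r}{k}^{-p/k}\big(f_{k-1}(\Delta)\big)^{p/k}.$$
   Context: A simplicial complex $\Delta$ on a finite vertex set $W$ is a collection of subsets of $W$ (faces) such that $\{v\}\in\Delta$ for every $v\in W$ and every subset of a face is a face. For $i \ge 1$, $f_{i-1}(\Delta)$ denotes the number of faces of $\Delta$ having exactly $i$ vertices. *)

theory Defs
  imports Complex_Main
begin

definition abstract_simplicial_complex :: "'a set \<Rightarrow> 'a set set \<Rightarrow> bool" where
  "abstract_simplicial_complex W \<Delta> \<longleftrightarrow>
     finite W \<and> \<Delta> \<subseteq> Pow W \<and> (\<forall>v\<in>W. {v} \<in> \<Delta>) \<and> (\<forall>F\<in>\<Delta>. \<forall>G. G \<subseteq> F \<longrightarrow> G \<in> \<Delta>)"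

(* The index is the dimension: a face of dimension d has d + 1 vertices. *)
definition face_number :: "'a set set \<Rightarrow> nat \<Rightarrow> nat" where
  "face_number \<Delta> d = card {F \<in> \<Delta>. card F = d + 1}"

end

(* Write t in (-1, 1] and B(r, j) = binom(r, j) + t binom(r-1, j-1). A shifting argument in the
   style of Frankl's proof of the Kruskal-Katona theorem shows that at least B(r, k) faces with
   k vertices force at least B(r, p) faces with p vertices. As t varies this is, in the
   (f_{k-1}, f_{p-1}) plane, the tangent at r to the power function of the theorem, so the concavity
   of x^{p/k} settles the range binom(r-1, k) < f_{k-1} <= binom(r, k) + binom(r-1, k-1).
   Smaller f_{k-1} are handled by induction on r, because binom(r, p) / binom(r, k)^{p/k} decreases
   in r, which is again an instance of Bernoulli's inequality. *)
theory Submission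
  imports Defs "HOL-Analysis.Convex"
begin

section \<open>Finite down-closed families\<close>

text \<open>The vertex set is left out because links and generated subfamilies have smaller ones;
  finiteness is required directly instead.\<close>

definition down_closed :: "'a set set \<Rightarrow> bool" where
  "down_closed \<Delta> \<longleftrightarrow> finite \<Delta> \<and> (\<forall>F\<in>\<Delta>. finite F) \<and> (\<forall>F\<in>\<Delta>. \<forall>G. G \<subseteq> F \<longrightarrow> G \<in> \<Delta>)"

definition faces :: "'a set set \<Rightarrow> nat \<Rightarrow> 'a set set" where
  "faces \<Delta> j = {F \<in> \<Delta>. card F = j}"

lemma face_number_eq_card_faces: "face_number \<Delta> d = card (faces \<Delta> (Suc d))"
  by (simp add: face_number_def faces_def)

lemma down_closed_subset: "down_closed \<Delta> \<Longrightarrow> F \<in> \<Delta> \<Longrightarrow> G \<subseteq> F \<Longrightarrow> G \<in> \<Delta>"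
  unfolding down_closed_def by blast

lemma down_closed_finite: "down_closed \<Delta> \<Longrightarrow> finite \<Delta>"
  unfolding down_closed_def by blast

lemma down_closed_finite_face: "down_closed \<Delta> \<Longrightarrow> F \<in> \<Delta> \<Longrightarrow> finite F"
  unfolding down_closed_def by blast

lemma finite_faces [simp]: "finite \<Delta> \<Longrightarrow> finite (faces \<Delta> j)"
  by (simp add: faces_def)

lemma abstract_simplicial_complex_down_closed:
  assumes "abstract_simplicial_complex W \<Delta>"
  shows "down_closed \<Delta>"
  using assms unfolding abstract_simplicial_complex_def down_closed_def
  by (auto intro: finite_subset[of _ "Pow W"] finite_subset[of _ W])

section \<open>Shifting towards a vertex\<close>

text \<open>The classical compression of extremal set theory, one face at a time. Blocking the
  exchange when its result is already a face makes the map injective.\<close>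

definition shift_face :: "'a set set \<Rightarrow> 'a \<Rightarrow> 'a \<Rightarrow> 'a set \<Rightarrow> 'a set" where
  "shift_face \<Delta> w v F =
     (if w \<in> F \<and> v \<notin> F \<and> insert v (F - {w}) \<notin> \<Delta> then insert v (F - {w}) else F)"

text \<open>Undoing the exchange recovers a moved face, and a moved face cannot meet an unmoved one
  because its image lies outside \<open>\<Delta>\<close>.\<close>

lemma inj_on_shift_face: "inj_on (shift_face \<Delta> w v) \<Delta>"
proof (rule inj_onI)
  fix F G assume FG: "F \<in> \<Delta>" "G \<in> \<Delta>" "shift_face \<Delta> w v F = shift_face \<Delta> w v G"
  have "F = G" if "w \<in> F" "v \<notin> F" "w \<in> G" "v \<notin> G" "insert v (F - {w}) = insert v (G - {w})"
  proof -
    from that have "F - {w} = G - {w}" by (simp add: insert_ident)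
    with that show ?thesis by (metis insert_Diff)
  qed
  with FG show "F = G" by (auto simp: shift_face_def split: if_splits)
qed

lemma card_shift_face: "finite F \<Longrightarrow> card (shift_face \<Delta> w v F) = card F"
  using card_Suc_Diff1[of F w] by (auto simp: shift_face_def)

text \<open>Sets separating \<open>v\<close> and \<open>w\<close> are paired by the exchange: a
  single face of a pair ends up on the side of \<open>v\<close>, while two faces stay put.\<close>

lemma mem_shift_iff:
  assumes "v \<noteq> w"
  shows "G \<in> shift_face \<Delta> w v ` \<Delta> \<longleftrightarrow>
    (if w \<in> G \<and> v \<notin> G then G \<in> \<Delta> \<and> insert v (G - {w}) \<in> \<Delta>
     else if v \<in> G \<and> w \<notin> G then G \<in> \<Delta> \<or> insert w (G - {v}) \<in> \<Delta>
     else G \<in> \<Delta>)" (is "?L = ?R")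
proof
  assume ?L
  then obtain F where F: "F \<in> \<Delta>" "G = shift_face \<Delta> w v F" by blast
  show ?R
  proof (cases "w \<in> F \<and> v \<notin> F \<and> insert v (F - {w}) \<notin> \<Delta>")
    case True
    then have "G = insert v (F - {w})" using F by (simp add: shift_face_def)
    moreover from this have "insert w (G - {v}) = F" using True assms by auto
    ultimately show ?thesis using F assms by auto
  next
    case False
    then have "G = F" using F by (auto simp: shift_face_def)
    then show ?thesis using F False by auto
  qed
next
  assume R: ?R
  show ?L
  proof (cases "G \<in> \<Delta>")
    case True
    then have "shift_face \<Delta> w v G = G" using R by (auto simp: shift_face_def)
    then show ?thesis using True by (metis imageI)
  next
    case False
    then have G: "v \<in> G" "w \<notin> G" "insert w (G - {v}) \<in> \<Delta>" using R by (auto split: if_splits)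
    have e: "insert v (insert w (G - {v}) - {w}) = G" using G by auto
    then have "shift_face \<Delta> w v (insert w (G - {v})) = G"
      using False assms by (simp add: shift_face_def)
    then show ?thesis using G by (metis imageI)
  qed
qed

text \<open>The exchange respects inclusions, so a subset of a shifted face is traced back to a
  subset of \<open>F\<close> or of its exchanged partner.\<close>

lemma down_closed_shift:
  assumes D: "down_closed \<Delta>" and vw: "v \<noteq> w"
  shows "down_closed (shift_face \<Delta> w v ` \<Delta>)"
proof -
  have sub: "G \<in> shift_face \<Delta> w v ` \<Delta>" if F: "F \<in> shift_face \<Delta> w v ` \<Delta>" and "G \<subseteq> F" for F G
  proof -
    note d = down_closed_subset[OF D]
    consider "w \<in> F" "v \<notin> F" | "v \<in> F" "w \<notin> F" | "w \<in> F" "v \<in> F" | "w \<notin> F" "v \<notin> F" by blast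
    then show ?thesis
    proof cases
      case 1
      then have a: "F \<in> \<Delta>" "insert v (F - {w}) \<in> \<Delta>" using F mem_shift_iff[OF vw, of F] by auto
      have "G \<in> \<Delta>" "insert v (G - {w}) \<in> \<Delta>"
        using d[OF a(1) \<open>G \<subseteq> F\<close>] d[OF a(2), of "insert v (G - {w})"] \<open>G \<subseteq> F\<close> by auto
      then show ?thesis using 1 \<open>G \<subseteq> F\<close> mem_shift_iff[OF vw, of G] by auto
    next
      case 2
      then have a: "F \<in> \<Delta> \<or> insert w (F - {v}) \<in> \<Delta>" using F mem_shift_iff[OF vw, of F] by auto
      have w: "w \<notin> G" using 2 \<open>G \<subseteq> F\<close> by auto
      have "v \<in> G \<Longrightarrow> G \<in> \<Delta> \<or> insert w (G - {v}) \<in> \<Delta>"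
        using a d[of F G] d[of "insert w (F - {v})" "insert w (G - {v})"] \<open>G \<subseteq> F\<close> by auto
      moreover have "v \<notin> G \<Longrightarrow> G \<in> \<Delta>"
        using a d[of F G] d[of "insert w (F - {v})" G] \<open>G \<subseteq> F\<close> by auto
      ultimately show ?thesis using w mem_shift_iff[OF vw, of G] by auto
    next
      case 3
      then have a: "F \<in> \<Delta>" using F mem_shift_iff[OF vw, of F] by auto
      have "G \<in> \<Delta>" using d[OF a \<open>G \<subseteq> F\<close>] .
      \<comment> \<open>This matters when \<open>G\<close> keeps \<open>w\<close> but loses
        \<open>v\<close>: its exchanged set still fits inside \<open>F\<close>.\<close>
      moreover have "insert v (G - {w}) \<in> \<Delta>"
        by (rule d[OF a]) (use 3 \<open>G \<subseteq> F\<close> in auto)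
      ultimately show ?thesis using mem_shift_iff[OF vw, of G] by auto
    next
      case 4
      then have a: "F \<in> \<Delta>" using F mem_shift_iff[OF vw, of F] by auto
      have "G \<in> \<Delta>" using d[OF a \<open>G \<subseteq> F\<close>] .
      then show ?thesis using 4 \<open>G \<subseteq> F\<close> mem_shift_iff[OF vw, of G] by auto
    qed
  qed
  have "finite (shift_face \<Delta> w v F)" if "F \<in> \<Delta>" for F
    using down_closed_finite_face[OF D that] by (simp add: shift_face_def)
  with sub show ?thesis using down_closed_finite[OF D] unfolding down_closed_def by blast
qed

lemma card_faces_shift:
  assumes "down_closed \<Delta>"
  shows "card (faces (shift_face \<Delta> w v ` \<Delta>) j) = card (faces \<Delta> j)"
proof -
  have "faces (shift_face \<Delta> w v ` \<Delta>) j = shift_face \<Delta> w v ` faces \<Delta> j"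
    using card_shift_face[OF down_closed_finite_face[OF assms]] by (auto simp: faces_def)
  moreover have "inj_on (shift_face \<Delta> w v) (faces \<Delta> j)"
    using inj_on_shift_face by (rule inj_on_subset) (auto simp: faces_def)
  ultimately show ?thesis by (simp add: card_image)
qed

text \<open>Stability towards one chosen vertex, without an order on the vertices: this is what
  comparing link and deletion at \<open>v\<close> requires.\<close>

definition shifted_to :: "'a \<Rightarrow> 'a set set \<Rightarrow> bool" where
  "shifted_to v \<Delta> \<longleftrightarrow> (\<forall>F\<in>\<Delta>. \<forall>w\<in>F. v \<notin> F \<longrightarrow> insert v (F - {w}) \<in> \<Delta>)"

text \<open>Each effective shift lowers the number of faces avoiding \<open>v\<close>, so shifting
  terminates, and it preserves all face counts.\<close>

lemma exists_shifted:
  assumes "down_closed \<Delta>" and "{v} \<in> \<Delta>"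
  shows "\<exists>\<Gamma>. down_closed \<Gamma> \<and> {v} \<in> \<Gamma> \<and> shifted_to v \<Gamma> \<and> card \<Gamma> = card \<Delta> \<and>
              (\<forall>j. card (faces \<Gamma> j) = card (faces \<Delta> j))"
  using assms
proof (induction "card {F \<in> \<Delta>. v \<notin> F}" arbitrary: \<Delta> rule: less_induct)
  case less
  show ?case
  proof (cases "shifted_to v \<Delta>")
    case True
    with less.prems show ?thesis by blast
  next
    case False
    then obtain F w where F: "F \<in> \<Delta>" "w \<in> F" "v \<notin> F" "insert v (F - {w}) \<notin> \<Delta>"
      unfolding shifted_to_def by blast
    then have vw: "v \<noteq> w" by auto
    let ?\<Gamma> = "shift_face \<Delta> w v ` \<Delta>"
    have dc: "down_closed ?\<Gamma>" using down_closed_shift[OF less.prems(1) vw] .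
    have v: "{v} \<in> ?\<Gamma>" using less.prems(2) vw mem_shift_iff[OF vw, of "{v}"] by auto
    have "{G \<in> ?\<Gamma>. v \<notin> G} \<subset> {G \<in> \<Delta>. v \<notin> G}"
    proof
      show "{G \<in> ?\<Gamma>. v \<notin> G} \<subseteq> {G \<in> \<Delta>. v \<notin> G}"
        by (auto simp: shift_face_def split: if_splits)
      show "{G \<in> ?\<Gamma>. v \<notin> G} \<noteq> {G \<in> \<Delta>. v \<notin> G}"
        using F mem_shift_iff[OF vw, of F \<Delta>] by (metis (mono_tags, lifting) mem_Collect_eq)
    qed
    then have "card {G \<in> ?\<Gamma>. v \<notin> G} < card {G \<in> \<Delta>. v \<notin> G}"
      using down_closed_finite[OF less.prems(1)] by (intro psubset_card_mono) auto
    from less.hyps[OF this dc v] show ?thesis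
      using card_faces_shift[OF less.prems(1)] card_image[OF inj_on_shift_face] by metis
  qed
qed

section \<open>Link and deletion of a vertex\<close>

definition link :: "'a \<Rightarrow> 'a set set \<Rightarrow> 'a set set" where
  "link v \<Delta> = {G. v \<notin> G \<and> insert v G \<in> \<Delta>}"

definition deletion :: "'a \<Rightarrow> 'a set set \<Rightarrow> 'a set set" where
  "deletion v \<Delta> = {F \<in> \<Delta>. v \<notin> F}"

lemma link_subset_deletion: "down_closed \<Delta> \<Longrightarrow> link v \<Delta> \<subseteq> deletion v \<Delta>"
  unfolding link_def deletion_def by (auto intro: down_closed_subset)

lemma down_closed_link:
  assumes "down_closed \<Delta>"
  shows "down_closed (link v \<Delta>)"
proof -
  have "finite (link v \<Delta>)"
    using link_subset_deletion[OF assms, of v] down_closed_finite[OF assms]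
    by (auto simp: deletion_def intro: finite_subset)
  moreover have "G \<in> link v \<Delta>" if "F \<in> link v \<Delta>" "G \<subseteq> F" for F G
    using that down_closed_subset[OF assms, of "insert v F" "insert v G"] by (auto simp: link_def)
  moreover have "finite F" if "F \<in> link v \<Delta>" for F
    using that down_closed_finite_face[OF assms, of "insert v F"] by (auto simp: link_def)
  ultimately show ?thesis unfolding down_closed_def by blast
qed

lemma card_faces_Suc:
  assumes "down_closed \<Delta>"
  shows "card (faces \<Delta> (Suc j)) = card (faces (deletion v \<Delta>) (Suc j)) + card (faces (link v \<Delta>) j)"
proof -
  have fin: "finite \<Delta>" using assms by (rule down_closed_finite)
  have fl: "finite (link v \<Delta>)" using down_closed_finite[OF down_closed_link[OF assms]] .
  have ff: "finite F" if "F \<in> \<Delta>" for F using assms that by (rule down_closed_finite_face)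
  have eq: "faces \<Delta> (Suc j) = faces (deletion v \<Delta>) (Suc j) \<union> insert v ` faces (link v \<Delta>) j"
  proof (intro set_eqI iffI)
    fix F assume F: "F \<in> faces \<Delta> (Suc j)"
    then have "finite F" using ff by (auto simp: faces_def)
    show "F \<in> faces (deletion v \<Delta>) (Suc j) \<union> insert v ` faces (link v \<Delta>) j"
    proof (cases "v \<in> F")
      case True
      then have "F = insert v (F - {v})" by blast
      moreover have "F - {v} \<in> faces (link v \<Delta>) j"
        using F True \<open>finite F\<close> by (auto simp: faces_def link_def insert_absorb)
      ultimately show ?thesis by blast
    qed (use F in \<open>auto simp: faces_def deletion_def\<close>)
  next
    fix F assume "F \<in> faces (deletion v \<Delta>) (Suc j) \<union> insert v ` faces (link v \<Delta>) j"
    then show "F \<in> faces \<Delta> (Suc j)"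
      using ff by (fastforce simp: faces_def link_def deletion_def)
  qed
  have inj: "inj_on (insert v) (faces (link v \<Delta>) j)"
    by (rule inj_onI) (auto simp: faces_def link_def)
  have disj: "faces (deletion v \<Delta>) (Suc j) \<inter> insert v ` faces (link v \<Delta>) j = {}"
    by (auto simp: faces_def deletion_def)
  have fd: "finite (deletion v \<Delta>)" using fin by (simp add: deletion_def)
  show ?thesis unfolding eq
    using card_Un_disjoint[OF _ _ disj] card_image[OF inj] fl fd by simp
qed

section \<open>The interpolated binomial bound\<close>

text \<open>This is B(r, j). The case \<open>0\<close> is separate because its second binomial
  should vanish, whereas the truncated lower index \<open>0 - 1\<close> would make it 1.\<close>

fun cascade :: "real \<Rightarrow> nat \<Rightarrow> nat \<Rightarrow> real" where
  "cascade t r 0 = 1"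
| "cascade t r (Suc q) = real (r choose Suc q) + t * real ((r - 1) choose q)"

text \<open>Pascal's rule in both terms; the two summands will be compared with the deletion and the
  link. At \<open>r = 0\<close> the truncated \<open>r - 1\<close> would break the rule.\<close>

lemma cascade_Suc:
  assumes "r > 0"
  shows "cascade t (Suc r) (Suc q) = cascade t r (Suc q) + cascade t r q"
proof -
  obtain s where "r = Suc s" using assms gr0_implies_Suc by blast
  then show ?thesis by (cases q) (auto simp: algebra_simps)
qed

text \<open>By Pascal's rule the first binomial is at least the second, so the value is at least 1 +
  t times the second, which is positive.\<close>

lemma cascade_pos:
  assumes "k \<le> r" and "-1 < t"
  shows "0 < cascade t r k"
proof (cases k)
  case (Suc q)
  then obtain s where s: "r = Suc s" "q \<le> s" using assms by (metis Suc_le_D Suc_le_mono)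
  have "0 < (1 + t) * real (s choose q)" using assms s by simp
  also have "\<dots> \<le> cascade t r k" using Suc s by (simp add: algebra_simps)
  finally show ?thesis .
qed simp

text \<open>The bound is exact for the initial segments of the colexicographic order at
  \<^term>\<open>t = 0\<close> and \<^term>\<open>t = 1\<close>.\<close>

theorem faces_ge_cascade:
  assumes "down_closed \<Delta>" and "-1 < t" and "t \<le> 1" and "p \<le> k" and "k \<le> r"
    and "cascade t r k \<le> card (faces \<Delta> k)"
  shows "cascade t r p \<le> card (faces \<Delta> p)"
  using assms
proof (induction "card \<Delta>" arbitrary: \<Delta> p k r rule: less_induct)
  case less
  note t = less.prems(2,3)
  \<comment> \<open>A face with \<open>k\<close> vertices supplies the empty face for
    \<open>p = 0\<close> and otherwise a vertex to shift towards.\<close>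
  have "card (faces \<Delta> k) > 0"
    using cascade_pos[OF less.prems(5) t(1)] less.prems(6) by linarith
  then obtain F where F: "F \<in> \<Delta>" "card F = k"
    by (force simp: faces_def card_gt_0_iff)
  consider "p = 0" | "p = k" | "0 < p" "p < k" using less.prems(4) by linarith
  then show ?case
  proof cases
    case 1
    have "{} \<in> \<Delta>" using down_closed_subset[OF less.prems(1) F(1)] by blast
    then have "{} \<in> faces \<Delta> 0" by (simp add: faces_def)
    then have "card (faces \<Delta> 0) > 0"
      using down_closed_finite[OF less.prems(1)] by (auto simp: card_gt_0_iff)
    then show ?thesis using 1 by simp
  next
    case 2
    then show ?thesis using less.prems by simp
  next
    case 3
    obtain q l s where pk: "p = Suc q" "k = Suc l" "r = Suc s" "q < l" "l \<le> s"
      using 3 less.prems(5) by (metis Suc_le_D Suc_le_mono Suc_less_eq gr0_implies_Suc less_trans)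
    obtain v where "v \<in> F" using F pk by fastforce
    then have "{v} \<in> \<Delta>" using down_closed_subset[OF less.prems(1) F(1)] by blast
    then obtain \<Gamma> where \<Gamma>: "down_closed \<Gamma>" "{v} \<in> \<Gamma>" "shifted_to v \<Gamma>" "card \<Gamma> = card \<Delta>"
      "\<And>j. card (faces \<Gamma> j) = card (faces \<Delta> j)"
      using exists_shifted[OF less.prems(1)] by metis
    define L D where "L = link v \<Gamma>" and "D = deletion v \<Gamma>"
    \<comment> \<open>The complex generated by the \<open>k\<close>-vertex faces of the deletion:
      its faces with one vertex fewer are exactly their shadow.\<close>
    define E where "E = {G. \<exists>F\<in>D. G \<subseteq> F \<and> card F = k}"
    have LD: "L \<subseteq> D" unfolding L_def D_def using link_subset_deletion[OF \<Gamma>(1)] .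
    \<comment> \<open>The deletion misses \<open>{v}\<close>, so \<open>L\<close> and
      \<open>E\<close> are small enough for the induction hypothesis.\<close>
    have "D \<subset> \<Gamma>" using \<Gamma>(2) by (auto simp: D_def deletion_def)
    have fin: "finite \<Gamma>" using \<Gamma>(1) by (rule down_closed_finite)
    then have finD: "finite D" using \<open>D \<subset> \<Gamma>\<close> finite_subset by blast
    have ED: "E \<subseteq> D"
      using down_closed_subset[OF \<Gamma>(1)] by (auto simp: E_def D_def deletion_def)
    have card_less: "card X < card \<Delta>" if "X \<subseteq> D" for X
      using psubset_card_mono[OF fin] that \<open>D \<subset> \<Gamma>\<close> \<Gamma>(4) by (metis subset_psubset_trans)
    have dL: "down_closed L" unfolding L_def using down_closed_link[OF \<Gamma>(1)] .
    have dE: "down_closed E"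
      unfolding down_closed_def
    proof (intro conjI ballI allI impI)
      show "finite E" using ED finD by (rule finite_subset)
    next
      fix F assume "F \<in> E"
      then show "finite F" using ED \<open>D \<subset> \<Gamma>\<close> down_closed_finite_face[OF \<Gamma>(1)] by blast
    next
      fix F G assume "F \<in> E" "G \<subseteq> F" then show "G \<in> E" unfolding E_def by blast
    qed
    \<comment> \<open>A shadow set is \<open>F - {w}\<close> with \<open>F\<close> avoiding
      \<open>v\<close>; shiftedness lets \<open>v\<close> replace \<open>w\<close>.\<close>
    have EL: "faces E l \<subseteq> faces L l"
    proof
      fix G assume G: "G \<in> faces E l"
      then obtain F where F: "F \<in> D" "G \<subseteq> F" "card F = Suc l" "card G = l"
        using pk by (auto simp: faces_def E_def)
      have "finite F" using F \<open>D \<subset> \<Gamma>\<close> down_closed_finite_face[OF \<Gamma>(1)] by blast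
      then have "card (F - G) = 1" using F by (simp add: card_Diff_subset finite_subset)
      then obtain w where w: "F - G = {w}" by (auto simp: card_1_singleton_iff)
      then have "w \<in> F" "F - {w} = G" using F by auto
      then have "insert v G \<in> \<Gamma>" "v \<notin> G"
        using \<Gamma>(3) F by (auto simp: shifted_to_def D_def deletion_def)
      then show "G \<in> faces L l" using F by (simp add: faces_def L_def link_def)
    qed
    then have EL': "card (faces E l) \<le> card (faces L l)"
      using down_closed_finite[OF dL] by (intro card_mono) auto
    have split: "card (faces \<Delta> (Suc j)) = card (faces D (Suc j)) + card (faces L j)" for j
      using card_faces_Suc[OF \<Gamma>(1), of j v] \<Gamma>(5) by (simp add: L_def D_def)
    have s0: "s > 0" using pk by simp
    \<comment> \<open>If the link were too small, the deletion would have so many faces with \<open>k\<close> vertices that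
      their shadow, which lies in the link by shiftedness, would contradict the smallness.\<close>
    have link_large: "cascade t s l \<le> card (faces L l)"
    proof (rule ccontr)
      assume neg: "\<not> ?thesis"
      \<comment> \<open>What the link lacks of its summand in Pascal's rule, the deletion must have
        in excess of its own.\<close>
      then have big: "cascade t s k < card (faces D k)"
        using less.prems(6) split[of l] cascade_Suc[OF s0, of t l] pk by simp
      have "faces E k = faces D k" using ED by (auto simp: faces_def E_def)
      show False
      proof (cases "k \<le> s")
        case True
        have "cascade t s l \<le> card (faces E l)"
          by (rule less.hyps[OF card_less[OF ED] dE t _ True])
            (use pk big \<open>faces E k = faces D k\<close> in auto)
        then show ?thesis using neg EL' by linarith
      next
        case False
        then have sl: "s = l" using pk by simp
        have "cascade t s k = 0" using pk sl s0 by (simp add: binomial_eq_0)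
        then obtain F where F: "F \<in> D" "card F = k"
          using big by (force simp: faces_def card_gt_0_iff)
        have "finite F" using F pk card.infinite by fastforce
        have "{G. G \<subseteq> F \<and> card G = l} \<subseteq> faces E l"
          using F by (auto simp: faces_def E_def)
        then have "card {G. G \<subseteq> F \<and> card G = l} \<le> card (faces E l)"
          using down_closed_finite[OF dE] by (intro card_mono) auto
        then have "k \<le> card (faces E l)"
          using n_subsets[OF \<open>finite F\<close>, of l] F pk by simp
        moreover have "cascade t s l \<le> 2" using t sl s0 by (cases l) auto
        ultimately show ?thesis using neg EL' pk by auto
      qed
    qed
    have IH: "cascade t s j \<le> card (faces L j)" if "j \<le> l" for j
      using less.hyps[OF card_less[OF LD] dL t that pk(5) link_large] .
    \<comment> \<open>The link also has many \<open>p\<close>-vertex faces, and they lie in the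
      deletion. Together with its \<open>q\<close>-vertex faces they give both summands of Pascal's
      rule.\<close>
    have "card (faces L p) \<le> card (faces D p)"
      using LD finD by (intro card_mono) (auto simp: faces_def)
    then show ?thesis
      using IH[of q] IH[of p] split[of q] cascade_Suc[OF s0, of t q] pk by simp
  qed
qed

section \<open>From the linear bound to the power bound\<close>

text \<open>Weighted mean inequality for \<open>y\<close> and 1 with weights \<open>a\<close> and
  \<open>1 - a\<close>; for \<open>y = 0\<close> the left side is 0.\<close>

lemma powr_le_tangent_at_1:
  fixes y a :: real
  assumes "0 \<le> y" and "0 \<le> a" and "a \<le> 1"
  shows "y powr a \<le> 1 + a * (y - 1)"
  using Youngs_inequality_0[of a "1 - a" y 1] assms by (cases "y = 0") (auto simp: algebra_simps)

lemma mult_binomial_pred: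
  assumes "0 < j"
  shows "real r * real ((r - 1) choose (j - 1)) = real j * real (r choose j)"
  using assms times_binomial_minus1_eq[of j r] by (metis of_nat_mult)

text \<open>Induction on \<open>r\<close> for a fixed family. Normalising by
  \<open>r choose k\<close> moves the point of tangency to 1, and positivity of the face count keeps
  \<open>k \<le> r\<close> when \<open>r\<close> is lowered.\<close>

lemma faces_ge_powr:
  assumes D: "down_closed \<Delta>" and p: "0 < p" "p < k" and r: "k \<le> r"
    and m: "0 < card (faces \<Delta> k)"
    and ub: "card (faces \<Delta> k) \<le> (r choose k) + ((r - 1) choose (k - 1))"
  shows "real (r choose p) * (real (card (faces \<Delta> k)) / real (r choose k)) powr (real p / real k)
           \<le> real (card (faces \<Delta> p))"
  using r ub
proof (induction r)
  case 0
  then show ?case using p by simp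
next
  case (Suc s)
  define M where "M = real (card (faces \<Delta> k))"
  define a where "a = real p / real k"
  have a: "0 \<le> a" "a \<le> 1" using p by (auto simp: a_def)
  have M: "0 < M" using m by (simp add: M_def)
  have posk: "0 < real (Suc s choose k)" using Suc.prems by simp
  have posp: "0 < real (Suc s choose p)" using Suc.prems p by simp
  \<comment> \<open>The lower binomials are the fractions k/(s+1) and p/(s+1) of the upper ones, and
    the second fraction is \<open>a\<close> times the first.\<close>
  have bk: "real (s choose (k - 1)) = real k / real (Suc s) * real (Suc s choose k)"
    using mult_binomial_pred[of k "Suc s"] p by (simp add: field_simps)
  have bp: "real (s choose (p - 1)) = real p / real (Suc s) * real (Suc s choose p)"
    using mult_binomial_pred[of p "Suc s"] p by (simp add: field_simps)
  have pascal_k: "real (Suc s choose k) = real (s choose (k - 1)) + real (s choose k)"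
    using p by (cases k) auto
  have pascal_p: "real (Suc s choose p) = real (s choose (p - 1)) + real (s choose p)"
    using p by (cases p) auto
  show ?case
  proof (cases "card (faces \<Delta> k) \<le> s choose k")
    case True
    then have ks: "k \<le> s" using m by (metis binomial_eq_0 leI le_0_eq less_irrefl)
    \<comment> \<open>The ratio of consecutive binomials for \<open>k\<close>; the tangent at 1,
      evaluated at \<open>x\<close>, is the same ratio for \<open>p\<close>.\<close>
    define x where "x = 1 - real k / real (Suc s)"
    have x: "0 < x" using ks by (simp add: x_def)
    have sk: "real (s choose k) = x * real (Suc s choose k)"
      using pascal_k bk by (simp add: x_def algebra_simps)
    have sp: "real (s choose p) = (1 - real p / real (Suc s)) * real (Suc s choose p)"
      using pascal_p bp by (simp add: algebra_simps)
    have "x powr a \<le> 1 + a * (x - 1)" using powr_le_tangent_at_1 x a by simp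
    also have "\<dots> = 1 - real p / real (Suc s)" using p by (simp add: x_def a_def)
    finally have xa: "x powr a * real (Suc s choose p) \<le> real (s choose p)"
      using posp unfolding sp by (intro mult_right_mono) auto
    have "M / real (Suc s choose k) = x * (M / real (s choose k))"
      using x posk by (simp add: sk)
    then have "real (Suc s choose p) * (M / real (Suc s choose k)) powr a
        = (x powr a * real (Suc s choose p)) * (M / real (s choose k)) powr a"
      using x M by (simp only: powr_mult mult_ac)
    also have "\<dots> \<le> real (s choose p) * (M / real (s choose k)) powr a"
      using xa by (intro mult_right_mono) auto
    also have "\<dots> \<le> real (card (faces \<Delta> p))"
      using Suc.IH[OF ks] True by (simp add: M_def a_def)
    finally show ?thesis by (simp add: M_def a_def)
  next
    case False
    \<comment> \<open>Chosen so that the face count equals B(s + 1, k). Exceeding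
      \<open>s choose k\<close> gives \<open>t > -1\<close> by Pascal's rule, and the assumed upper
      bound gives \<open>t \<le> 1\<close>.\<close>
    define t where "t = (M - real (Suc s choose k)) / real (s choose (k - 1))"
    have pos: "0 < real (s choose (k - 1))" using Suc.prems by simp
    have t1: "-1 < t" using False pos pascal_k by (simp add: t_def M_def field_simps)
    have t2: "t \<le> 1"
    proof -
      have "M \<le> real ((Suc s choose k) + ((Suc s - 1) choose (k - 1)))"
        unfolding M_def using Suc.prems(2) of_nat_le_iff by blast
      then show ?thesis using pos by (simp add: t_def field_simps)
    qed
    have Mt: "M = real (Suc s choose k) + t * real (s choose (k - 1))"
      using pos by (simp add: t_def)
    have "cascade t (Suc s) k = M" using p Mt by (cases k) auto
    then have "cascade t (Suc s) p \<le> card (faces \<Delta> p)"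
      using faces_ge_cascade[OF D t1 t2, of p k "Suc s"] p Suc.prems by (simp add: M_def)
    moreover have "cascade t (Suc s) p = real (Suc s choose p) + t * real (s choose (p - 1))"
      using p by (cases p) auto
    \<comment> \<open>Multiplied by \<open>a\<close> this is t p/(s+1), so the tangent scaled by
      \<open>Suc s choose p\<close> is exactly B(s + 1, p).\<close>
    moreover have "M / real (Suc s choose k) - 1 = t * real k / real (Suc s)"
      using posk unfolding Mt bk by (simp add: diff_divide_distrib add_divide_distrib)
    then have "real (Suc s choose p) + t * real (s choose (p - 1))
        = real (Suc s choose p) * (1 + a * (M / real (Suc s choose k) - 1))"
      using p unfolding bp by (simp add: a_def algebra_simps)
    moreover have "(M / real (Suc s choose k)) powr a \<le> 1 + a * (M / real (Suc s choose k) - 1)"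
      using powr_le_tangent_at_1 M posk a by simp
    then have "real (Suc s choose p) * (M / real (Suc s choose k)) powr a
        \<le> real (Suc s choose p) * (1 + a * (M / real (Suc s choose k) - 1))"
      using posp by (intro mult_left_mono) auto
    ultimately show ?thesis by (simp add: M_def a_def)
  qed
qed

theorem theorem1p5:
  fixes W :: "'a set" and \<Delta> :: "'a set set" and r k p :: nat
  assumes "abstract_simplicial_complex W \<Delta>"
    and "r \<ge> k" and "k > p" and "p > 0"
    and "face_number \<Delta> (k - 1) \<le> (r choose k) + ((r - 1) choose (k - 1))"
  shows "real (face_number \<Delta> (p - 1)) \<ge>
           real (r choose p) * real (r choose k) powr (- (real p / real k))
             * real (face_number \<Delta> (k - 1)) powr (real p / real k)"
proof (cases "face_number \<Delta> (k - 1) = 0")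
  case True
  then show ?thesis by simp
next
  case False
  \<comment> \<open>Dimensions become vertex counts; \<open>k - 1\<close> and \<open>p - 1\<close>
    are not truncated since both numbers are positive.\<close>
  have k: "face_number \<Delta> (k - 1) = card (faces \<Delta> k)"
    and p: "face_number \<Delta> (p - 1) = card (faces \<Delta> p)"
    using assms by (auto simp: face_number_eq_card_faces)
  have "real (r choose p) * (real (card (faces \<Delta> k)) / real (r choose k)) powr (real p / real k)
           \<le> real (card (faces \<Delta> p))"
    by (rule faces_ge_powr[OF abstract_simplicial_complex_down_closed[OF assms(1)]])
      (use assms False k in auto)
  then show ?thesis unfolding k p by (simp add: powr_divide powr_minus field_simps)
qed

end
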